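(* The following universal sets exist. (i) There is an $F_\sigma$ set $U\subseteq\omega^\omega\times\omega^\omega$ that is universal for the ideal of countable subsets of $\omega^\omega$. (ii) For every Polish space $X$ there is an $F_\sigma$ set $U\subseteq\omega^\omega\times X$ that is universal for the $\sigma$-ideal $\mathcal{M}(X)$ of meager subsets of $X$. (iii) There is a $G_\delta$ set $U\subseteq\omega^\omega\times 2^\omega$ that is universal for the $\sigma$-ideal $\mathcal{N}$ of null subsets of $2^\omega$, where $2^\omega$ is equipped with the Haar measure. (iv) There is an $F_\sigma$ set $U\subseteq\omega^\omega\times 2^\omega$ that is universal for the $\sigma$-ideal $\mathcal{E}$ of subsets of $2^\omega$ generated by the closed sets of Haar measure zero. (v) There is an $F_\sigma$ set $U\subseteq\omega^\omega\times\omega^\omega$ that is universal for the $\sigma$-ideal $\mathcal{K}_\sigma$ of subsets of $\omega^\omega$ generated by the compact subsets of $\omega^\omega$. (vi) There is a $G_\delta$ set $U\subseteq\omega^\omega\times\omega^\omega$ that is universal for the Laver ideal on $\omega^\omega$.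
   Context: For $U\subseteq\omega^\omega\times X$ and $x\in\omega^\omega$, the vertical section is $U_x=\{y\in X:(x,y)\in U\}$. A base of an ideal $\mathcal{I}$ of subsets of $X$ is a family $\mathcal{F}\subseteq\mathcal{I}$ such that for each $A\in\mathcal{I}$ there is $A'\in\mathcal{F}$ with $A\subseteq A'$. A set $U\subseteq\omega^\omega\times X$ is called universal for an ideal $\mathcal{I}$ of subsets of $X$ if $U_x\in\mathcal{I}$ for all $x\in\omega^\omega$ and the family $\{U_x:x\in\omega^\omega\}$ is a base of $\mathcal{I}$. The $\sigma$-ideal generated by a family of sets consists of all subsets of countable unions of members of that family. The Haar measure on $2^\omega$ is the product of the uniform probability measures on $\{0,1\}$; null sets are the sets of measure zero (subsets of measurable sets of measure zero). A set $A\subseteq\omega^\omega$ is strongly dominating if for every $\Phi:\omega^{<\omega}\to\omega$ there exists $f\in A$ such that $f(n)\geq\Phi(f|_n)$ for all but finitely many $n\in\omega$, where $\omega^{<\omega}$ is the set of finite sequences of natural numbers and $f|_n=(f(0),\dots,f(n-1))$. The Laver ideal is the family of all subsets of $\omega^\omega$ which are not strongly dominating. *)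

theory Defs
  imports "HOL-Probability.Probability"
begin

section \<open>Universal sets for ideals\<close>

text \<open>
  The Baire space is the type \<^typ>\<open>nat \<Rightarrow> nat\<close> and the Cantor space the type
  \<^typ>\<open>nat \<Rightarrow> bool\<close>; on both, \<^term>\<open>euclidean\<close> is the product of the discrete topologies
  (fact \<open>euclidean_product_topology\<close>).
\<close>

definition vertical_section :: "('a \<times> 'b) set \<Rightarrow> 'a \<Rightarrow> 'b set" where
  "vertical_section U x = {y. (x, y) \<in> U}"

definition ideal_base :: "'a set set \<Rightarrow> 'a set set \<Rightarrow> bool" where
  "ideal_base \<F> \<I> \<longleftrightarrow> \<F> \<subseteq> \<I> \<and> (\<forall>A\<in>\<I>. \<exists>A'\<in>\<F>. A \<subseteq> A')"

definition universal_for :: "((nat \<Rightarrow> nat) \<times> 'a) set \<Rightarrow> 'a set \<Rightarrow> 'a set set \<Rightarrow> bool" where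
  "universal_for U X \<I> \<longleftrightarrow>
     U \<subseteq> UNIV \<times> X \<and>
     (\<forall>x. vertical_section U x \<in> \<I>) \<and>
     ideal_base (range (vertical_section U)) \<I>"

definition sigma_ideal_generated :: "'a set set \<Rightarrow> 'a set set" where
  "sigma_ideal_generated \<F> = {A. \<exists>\<G>. countable \<G> \<and> \<G> \<subseteq> \<F> \<and> A \<subseteq> \<Union>\<G>}"


section \<open>Polish spaces and meager sets\<close>

text \<open>
  The library's type class of Polish spaces only covers topologies on a whole type together with a
  fixed complete metric, hence the version for arbitrary topologies.
\<close>

definition Polish_space :: "'a topology \<Rightarrow> bool" where
  "Polish_space X \<longleftrightarrow> separable_space X \<and> completely_metrizable_space X"

definition nowhere_dense_in :: "'a topology \<Rightarrow> 'a set \<Rightarrow> bool" where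
  "nowhere_dense_in X S \<longleftrightarrow> S \<subseteq> topspace X \<and> X interior_of (X closure_of S) = {}"

definition meager_in :: "'a topology \<Rightarrow> 'a set \<Rightarrow> bool" where
  "meager_in X A \<longleftrightarrow> (\<exists>\<G>. countable \<G> \<and> (\<forall>S\<in>\<G>. nowhere_dense_in X S) \<and> A = \<Union>\<G>)"


section \<open>Haar measure on the Cantor space\<close>

text \<open>Its sigma-algebra is that of the Borel sets (fact \<open>sets_PiM_equal_borel\<close>).\<close>

definition haar :: "(nat \<Rightarrow> bool) measure" where
  "haar = PiM UNIV (\<lambda>_. uniform_count_measure UNIV)"

definition haar_null :: "(nat \<Rightarrow> bool) set \<Rightarrow> bool" where
  "haar_null A \<longleftrightarrow> (\<exists>N\<in>null_sets haar. A \<subseteq> N)"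


section \<open>The Laver ideal\<close>

text \<open>\<^term>\<open>map f [0..<n]\<close> is the restriction of \<^term>\<open>f\<close> to its first \<^term>\<open>n\<close> values.\<close>

definition strongly_dominating :: "(nat \<Rightarrow> nat) set \<Rightarrow> bool" where
  "strongly_dominating A \<longleftrightarrow>
     (\<forall>\<Phi> :: nat list \<Rightarrow> nat. \<exists>f\<in>A. \<forall>\<^sub>F n in sequentially. f n \<ge> \<Phi> (map f [0..<n]))"

definition laver_ideal :: "(nat \<Rightarrow> nat) set set" where
  "laver_ideal = {A. \<not> strongly_dominating A}"

end

theory Submission
  imports Defs
begin

text \<open>
  The four ideals with \<open>F\<^sub>\<sigma>\<close> universal sets are the \<open>\<sigma>\<close>-ideals generated by singletons, nowhere
  dense sets, closed null sets and compact sets. A point \<open>x\<close> of the Baire space codes the countable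
  sequence of its rows, so it suffices to code one generator at a time
  (\<open>fsigma_universal_for_sigma_ideal\<close>): if \<open>P\<close> is a closed set whose sections are generators, and
  each generator is contained in a section of \<open>P\<close>, then the points \<open>(x, y)\<close> with \<open>(row k x, y) \<in> P\<close>
  for some \<open>k\<close> form the required set.

  For singletons \<open>P\<close> is the diagonal, and for compact sets it is \<open>{(x, y). \<forall>k. y k \<le> x k}\<close>. The
  other two cases delete open sets \<open>c n (x n)\<close> one after the other (\<open>omitting\<close>). The set \<open>c n m\<close>
  has to witness the \<open>n\<close>-th of countably many requirements which together make the remainder small.
  For nowhere dense sets, the requirement is to meet the \<open>n\<close>-th set of a countable base; for closed
  null sets, it is to leave a remainder of measure at most \<open>(1/2)^n\<close>. A code \<open>m\<close> that violates the
  requirement is replaced by a default set that satisfies it, so that every \<open>x\<close> codes a generator.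

  A null set is contained in an intersection of open sets \<open>V k\<close> of measure at most \<open>(1/2)^k\<close>.
  All open sets of measure at most \<open>e\<close> are the sections of one open set
  (\<open>ex_open_coding_small_open_sets\<close>): a code lists basic open sets, and an entry of the list counts
  only if the union up to that entry has measure at most \<open>e\<close>. The rows of \<open>x\<close> code the \<open>V k\<close>, and
  intersecting over \<open>k\<close> gives a \<open>G\<^sub>\<delta>\<close> set.

  A set is in the Laver ideal iff for some \<open>\<Phi>\<close> each of its elements \<open>f\<close> satisfies \<open>f n < \<Phi> (f|n)\<close> for
  infinitely many \<open>n\<close>. Since finite sequences are countably many, \<open>\<Phi>\<close> is coded by a point of the
  Baire space, and the condition is \<open>G\<^sub>\<delta>\<close> in \<open>(\<Phi>, f)\<close>.
\<close>

section \<open>Topological preliminaries\<close>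

lemma separable_metrizable_imp_second_countable:
  assumes "metrizable_space X" "separable_space X"
  shows "second_countable X"
proof -
  obtain M d where "Metric_space M d" and X: "X = Metric_space.mtopology M d"
    using assms(1) unfolding metrizable_space_def by blast
  interpret Metric_space M d by fact
  obtain C where C: "countable C" "C \<subseteq> M" "mtopology closure_of C = M"
    using assms(2) unfolding separable_space_def X by auto
  define \<B> where "\<B> = (\<lambda>(c, n). mball c (inverse (real (Suc n)))) ` (C \<times> UNIV)"
  have "\<exists>V\<in>\<B>. x \<in> V \<and> V \<subseteq> U" if U: "openin X U" "x \<in> U" for U x
  proof -
    obtain r where r: "r > 0" "mball x r \<subseteq> U" "x \<in> M"
      using U unfolding X openin_mtopology by blast
    obtain n where n: "inverse (real (Suc n)) < r / 2"
      using reals_Archimedean[of "r / 2"] r(1) by auto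
    have "x \<in> mtopology closure_of C"
      using C(3) r(3) by simp
    then obtain c where c: "c \<in> C" "c \<in> mball x (inverse (real (Suc n)))"
      unfolding metric_closure_of using inverse_positive_iff_positive of_nat_0_less_iff zero_less_Suc by blast
    have "mball c (inverse (real (Suc n))) \<subseteq> mball x r"
    proof
      fix z assume z: "z \<in> mball c (inverse (real (Suc n)))"
      then have "d x z \<le> d x c + d c z"
        using c r(3) by (intro triangle) auto
      then show "z \<in> mball x r"
        using z c n by auto
    qed
    moreover have "x \<in> mball c (inverse (real (Suc n)))"
      using c by (auto simp: commute)
    ultimately show ?thesis
      using c(1) r(2) unfolding \<B>_def by blast
  qed
  moreover have "countable \<B>" "\<forall>V\<in>\<B>. openin X V"
    using C(1) unfolding \<B>_def X by auto
  ultimately show ?thesis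
    unfolding second_countable_def by blast
qed

lemma second_countable_euclidean:
  "second_countable (euclidean :: 'a::second_countable_topology topology)"
proof -
  obtain \<B> :: "'a set set" where \<B>: "countable \<B>" "topological_basis \<B>"
    using ex_countable_basis by blast
  show ?thesis
    unfolding second_countable_def
  proof (intro exI[of _ \<B>] conjI allI impI)
    show "\<forall>V\<in>\<B>. openin euclidean V"
      using \<B>(2) topological_basis_open by auto
    show "\<exists>V\<in>\<B>. x \<in> V \<and> V \<subseteq> U" if "openin euclidean U \<and> x \<in> U" for U x
      using that topological_basisE[OF \<B>(2), of U x] by auto
  qed fact
qed

text \<open>
  A code lists one basic set for every natural number, also when the coded open set is to have fewer
  basic subsets; index \<open>0\<close>, reserved for the empty set, pads the list.
\<close>

lemma second_countable_enumerated_base: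
  assumes "second_countable X"
  obtains b :: "nat \<Rightarrow> 'a set" where
    "b 0 = {}" "\<And>n. openin X (b n)"
    "\<And>U. openin X U \<Longrightarrow> (\<Union>n. b (if b n \<subseteq> U then n else 0)) = U"
proof -
  obtain \<B> where \<B>: "countable \<B>" "\<And>V. V \<in> \<B> \<Longrightarrow> openin X V"
    "\<And>U x. openin X U \<Longrightarrow> x \<in> U \<Longrightarrow> \<exists>V\<in>\<B>. x \<in> V \<and> V \<subseteq> U"
    using assms unfolding second_countable_def by metis
  define b where "b n = (case n of 0 \<Rightarrow> {} | Suc m \<Rightarrow> from_nat_into (insert {} \<B>) m)" for n
  show thesis
  proof
    show "b 0 = {}"
      by (simp add: b_def)
    have "from_nat_into (insert {} \<B>) m \<in> insert {} \<B>" for m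
      by (intro from_nat_into) simp
    then show "openin X (b n)" for n
      unfolding b_def using \<B>(2) openin_empty[of X] by (cases n) (simp, metis insert_iff nat.case(2))
    show "(\<Union>n. b (if b n \<subseteq> U then n else 0)) = U" if U: "openin X U" for U
    proof (intro equalityI subsetI)
      fix x assume "x \<in> U"
      then obtain V where V: "V \<in> \<B>" "x \<in> V" "V \<subseteq> U"
        using \<B>(3) U by blast
      obtain m where "from_nat_into (insert {} \<B>) m = V"
        using from_nat_into_surj[of "insert {} \<B>" V] \<B>(1) V(1) by auto
      then have "b (Suc m) = V"
        by (simp add: b_def)
      then show "x \<in> (\<Union>n. b (if b n \<subseteq> U then n else 0))"
        using V by (intro UN_I[of "Suc m"]) auto
    qed (auto simp: b_def split: if_splits)
  qed
qed

lemma open_enumerated_base: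
  obtains b :: "nat \<Rightarrow> 'a::second_countable_topology set" where
    "\<And>n. open (b n)"
    "\<And>U. open U \<Longrightarrow> (\<Union>n. b (if b n \<subseteq> U then n else 0)) = U"
  using second_countable_enumerated_base[OF second_countable_euclidean]
  unfolding open_openin[symmetric] by metis

text \<open>
  A condition that reads only finitely many coordinates of a point of the Baire space is open, even
  if the choice of these coordinates depends on the point. Phrased with \<^term>\<open>nhds\<close>, this is the
  conjunction of finitely many instances of the next facts.
\<close>

lemma eventually_nhds_eq_discrete:
  fixes f :: "'a::topological_space \<Rightarrow> 'b::discrete_topology"
  assumes "continuous_on UNIV f"
  shows "\<forall>\<^sub>F q in nhds p. f q = f p"
proof -
  have "open (f -` {f p})"
    by (rule open_vimage[OF discrete_topology_class.open_discrete assms])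
  then show ?thesis
    unfolding eventually_nhds by (intro exI[of _ "f -` {f p}"]) auto
qed

lemma eventually_nhds_fst_coordinate:
  fixes p :: "(nat \<Rightarrow> nat) \<times> 'b::topological_space"
  shows "\<forall>\<^sub>F q in nhds p. fst q n = fst p n"
  by (intro eventually_nhds_eq_discrete
      continuous_on_product_then_coordinatewise[OF continuous_on_fst[OF continuous_on_id]])

lemma eventually_nhds_snd_coordinate:
  fixes p :: "'b::topological_space \<times> (nat \<Rightarrow> nat)"
  shows "\<forall>\<^sub>F q in nhds p. snd q n = snd p n"
  by (intro eventually_nhds_eq_discrete
      continuous_on_product_then_coordinatewise[OF continuous_on_snd[OF continuous_on_id]])

lemma open_if_eventually_nhds:
  assumes "\<And>p. p \<in> S \<Longrightarrow> \<forall>\<^sub>F q in nhds p. q \<in> S"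
  shows "open S"
proof (subst open_subopen, intro ballI)
  fix p assume "p \<in> S"
  then show "\<exists>T. open T \<and> p \<in> T \<and> T \<subseteq> S"
    using assms[of p] unfolding eventually_nhds by blast
qed

lemma gdelta_in_INT_open:
  fixes W :: "nat \<Rightarrow> 'a::topological_space set"
  assumes "\<And>k. open (W k)"
  shows "gdelta_in euclidean (\<Inter>k. W k)"
  using assms by (intro gdelta_in_Inter) (auto intro!: open_imp_gdelta_in)

section \<open>Coding sequences of parameters\<close>

lemma universal_forI:
  assumes "U \<subseteq> UNIV \<times> X"
    and "\<And>x. vertical_section U x \<in> \<I>"
    and "\<And>A. A \<in> \<I> \<Longrightarrow> \<exists>x. A \<subseteq> vertical_section U x"
  shows "universal_for U X \<I>"
  using assms unfolding universal_for_def ideal_base_def by (simp add: image_subset_iff)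

definition row :: "nat \<Rightarrow> (nat \<Rightarrow> 'a) \<Rightarrow> nat \<Rightarrow> 'a" where
  "row k x n = x (prod_encode (k, n))"

lemma ex_rows: "\<exists>x. \<forall>k. row k x = z k"
proof (intro exI allI ext)
  show "row k (\<lambda>m. case prod_decode m of (k, n) \<Rightarrow> z k n) n = z k n" for k n
    by (simp add: row_def)
qed

lemma continuous_on_row: "continuous_on UNIV (row k :: (nat \<Rightarrow> 'a::topological_space) \<Rightarrow> _)"
  unfolding row_def
  by (rule continuous_on_coordinatewise_then_product) (rule continuous_on_product_coordinates)

lemma continuous_map_row:
  "continuous_map (prod_topology euclidean X) (prod_topology euclidean X)
     (\<lambda>(x :: nat \<Rightarrow> 'a::topological_space, y). (row k x, y))"
  unfolding continuous_map_prod_top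
  by (simp add: continuous_on_row)

text \<open>
  The witness is the union over \<open>k\<close> of the preimages of \<open>P\<close> under \<open>(x, y) \<mapsto> (row k x, y)\<close>. Its
  section at \<open>x\<close> is the union of the sections of \<open>P\<close> at the rows of \<open>x\<close>, and the rows can be
  prescribed independently.
\<close>

lemma fsigma_universal_for_sigma_ideal:
  fixes P :: "((nat \<Rightarrow> nat) \<times> 'a) set"
  assumes P: "closedin (prod_topology euclidean X) P"
    and sections: "\<And>x. vertical_section P x \<in> \<F>"
    and cofinal: "\<And>A. A \<in> \<F> \<Longrightarrow> \<exists>x. A \<subseteq> vertical_section P x"
  shows "\<exists>U. fsigma_in (prod_topology euclidean X) U \<and>
             universal_for U (topspace X) (sigma_ideal_generated \<F>)"
proof -
  let ?\<tau> = "prod_topology (euclidean :: (nat \<Rightarrow> nat) topology) X"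
  define U where "U = (\<Union>k. {p \<in> topspace ?\<tau>. (\<lambda>(x, y). (row k x, y)) p \<in> P})"
  have "fsigma_in ?\<tau> {p \<in> topspace ?\<tau>. (\<lambda>(x, y). (row k x, y)) p \<in> P}" for k
    by (intro closed_imp_fsigma_in closedin_continuous_map_preimage[OF continuous_map_row P])
  then have fsigma: "fsigma_in ?\<tau> U"
    unfolding U_def by (intro fsigma_in_Union) auto
  have PX: "P \<subseteq> UNIV \<times> topspace X"
    using closedin_subset[OF P] by simp
  have section_U: "vertical_section U x = (\<Union>k. vertical_section P (row k x))" for x
    using PX unfolding U_def vertical_section_def by auto
  have "vertical_section U x \<in> sigma_ideal_generated \<F>" for x
    unfolding sigma_ideal_generated_def section_U
    using sections by (intro CollectI exI[of _ "range (\<lambda>k. vertical_section P (row k x))"]) auto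
  moreover have "\<exists>x. A \<subseteq> vertical_section U x" if "A \<in> sigma_ideal_generated \<F>" for A
  proof -
    obtain \<G> where \<G>: "countable \<G>" "\<G> \<subseteq> \<F>" "A \<subseteq> \<Union>\<G>"
      using \<open>A \<in> _\<close> unfolding sigma_ideal_generated_def by blast
    have "\<forall>G\<in>\<G>. \<exists>z. G \<subseteq> vertical_section P z"
      using cofinal \<G>(2) by blast
    then obtain z where z: "\<And>G. G \<in> \<G> \<Longrightarrow> G \<subseteq> vertical_section P (z G)"
      by metis
    obtain x where x: "\<And>k. row k x = z (from_nat_into \<G> k)"
      using ex_rows[of "\<lambda>k. z (from_nat_into \<G> k)"] by blast
    have "G \<subseteq> vertical_section U x" if G: "G \<in> \<G>" for G
    proof -
      obtain k where "from_nat_into \<G> k = G"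
        using from_nat_into_surj[OF \<G>(1) G] by blast
      then have "G \<subseteq> vertical_section P (row k x)"
        using z[OF G] x by simp
      then show ?thesis
        unfolding section_U by blast
    qed
    then show ?thesis
      using \<G>(3) by blast
  qed
  moreover have "U \<subseteq> UNIV \<times> topspace X"
    unfolding U_def by auto
  ultimately have "universal_for U (topspace X) (sigma_ideal_generated \<F>)"
    by (intro universal_forI)
  then show ?thesis
    using fsigma by blast
qed

definition omitting :: "'a topology \<Rightarrow> (nat \<Rightarrow> nat \<Rightarrow> 'a set) \<Rightarrow> ((nat \<Rightarrow> nat) \<times> 'a) set" where
  "omitting X c = {(x, y). y \<in> topspace X \<and> (\<forall>n. y \<notin> c n (x n))}"

lemma vertical_section_omitting:
  "vertical_section (omitting X c) x = topspace X - (\<Union>n. c n (x n))"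
  unfolding vertical_section_def omitting_def by auto

text \<open>
  The complement is the union of the open rectangles \<open>{x. x n = m} \<times> c n m\<close>.
\<close>

lemma closedin_omitting:
  assumes "\<And>n m. openin X (c n m)"
  shows "closedin (prod_topology euclidean X) (omitting X c)"
proof -
  have "open {x :: nat \<Rightarrow> nat. x n = m}" for n m
  proof -
    have "open ((\<lambda>x :: nat \<Rightarrow> nat. x n) -` {m})"
      by (rule open_vimage[OF discrete_topology_class.open_discrete continuous_on_product_coordinates])
    then show ?thesis
      by (simp add: vimage_def)
  qed
  then have "openin (prod_topology euclidean X) (\<Union>n m. {x :: nat \<Rightarrow> nat. x n = m} \<times> c n m)"
    (is "openin ?\<tau> ?V")
    using assms by (intro openin_clauses(3) openin_Union ballI) (auto simp: openin_prod_Times_iff)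
  then have "closedin ?\<tau> (topspace ?\<tau> - ?V)"
    by (rule closedin_diff[OF closedin_topspace])
  moreover have "omitting X c = topspace ?\<tau> - ?V"
    unfolding omitting_def by auto
  ultimately show ?thesis
    by (simp only:)
qed

section \<open>Countable, \<open>\<sigma>\<close>-compact and meager sets\<close>

lemma fsigma_universal_for_countable:
  "\<exists>U. fsigma_in (prod_topology euclidean euclidean) U \<and>
       universal_for U UNIV {A :: (nat \<Rightarrow> nat) set. countable A}"
proof -
  have "{A :: (nat \<Rightarrow> nat) set. countable A} = sigma_ideal_generated (range (\<lambda>x. {x}))"
  proof (intro equalityI subsetI)
    fix A :: "(nat \<Rightarrow> nat) set"
    assume "A \<in> {A. countable A}"
    then show "A \<in> sigma_ideal_generated (range (\<lambda>x. {x}))"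
      unfolding sigma_ideal_generated_def by (intro CollectI exI[of _ "(\<lambda>x. {x}) ` A"]) auto
  next
    fix A :: "(nat \<Rightarrow> nat) set"
    assume "A \<in> sigma_ideal_generated (range (\<lambda>x. {x}))"
    then obtain \<G> where "countable \<G>" "\<G> \<subseteq> range (\<lambda>x. {x})" "A \<subseteq> \<Union>\<G>"
      unfolding sigma_ideal_generated_def by blast
    moreover from this have "countable (\<Union>\<G>)"
      using countable_UN[of \<G> id] by auto
    ultimately show "A \<in> {A. countable A}"
      using countable_subset by blast
  qed
  moreover have "\<exists>U. fsigma_in (prod_topology euclidean euclidean) U \<and>
      universal_for U (topspace euclidean) (sigma_ideal_generated (range (\<lambda>x :: nat \<Rightarrow> nat. {x})))"
  proof (rule fsigma_universal_for_sigma_ideal)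
    let ?\<Delta> = "{p :: (nat \<Rightarrow> nat) \<times> (nat \<Rightarrow> nat). \<forall>k. snd p k = fst p k}"
    have "closed ?\<Delta>"
      by (intro closed_Collect_all closed_Collect_eq
          continuous_on_product_then_coordinatewise[OF continuous_on_fst[OF continuous_on_id]]
          continuous_on_product_then_coordinatewise[OF continuous_on_snd[OF continuous_on_id]])
    then show "closedin (prod_topology euclidean euclidean) ?\<Delta>"
      by simp
    have "vertical_section ?\<Delta> z = {z}" for z
      unfolding vertical_section_def by auto
    then show "vertical_section ?\<Delta> z \<in> range (\<lambda>x. {x})"
      and "A \<in> range (\<lambda>x. {x}) \<Longrightarrow> \<exists>x. A \<subseteq> vertical_section ?\<Delta> x" for z A
      by auto
  qed
  ultimately show ?thesis
    by simp
qed

text \<open>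
  A product of finite sets is compact, and each coordinate of a compact set ranges over a compact,
  hence finite, subset of a discrete space. So the compact sets are cofinally the sets of functions
  below a fixed function.
\<close>

lemma fsigma_universal_for_K_sigma:
  "\<exists>U. fsigma_in (prod_topology euclidean euclidean) U \<and>
       universal_for U UNIV (sigma_ideal_generated {K :: (nat \<Rightarrow> nat) set. compact K})"
proof -
  define P where "P = {p :: (nat \<Rightarrow> nat) \<times> (nat \<Rightarrow> nat). \<forall>k. snd p k \<le> fst p k}"
  have "closed P"
    unfolding P_def
    by (intro closed_Collect_all closed_Collect_le
        continuous_on_product_then_coordinatewise[OF continuous_on_fst[OF continuous_on_id]]
        continuous_on_product_then_coordinatewise[OF continuous_on_snd[OF continuous_on_id]])
  have section_P: "vertical_section P x = Pi\<^sub>E UNIV (\<lambda>k. {..x k})" for x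
    unfolding vertical_section_def P_def by (auto simp: PiE_def)
  have "compact (vertical_section P x)" for x
  proof -
    have "compactin (product_topology (\<lambda>_. euclidean) UNIV) (Pi\<^sub>E UNIV (\<lambda>k. {..x k}))"
      by (simp add: compactin_PiE finite_imp_compact)
    then show ?thesis
      unfolding section_P euclidean_product_topology by simp
  qed
  moreover have "\<exists>x. K \<subseteq> vertical_section P x" if "compact K" for K
  proof -
    have "finite ((\<lambda>y. y k) ` K)" for k
    proof -
      have "compact ((\<lambda>y. y k) ` K)"
        using that by (intro compact_continuous_image continuous_on_subset[OF continuous_on_product_coordinates]) auto
      then obtain C where "C \<subseteq> (\<lambda>y. y k) ` K" "finite C" "(\<lambda>y. y k) ` K \<subseteq> (\<Union>c\<in>C. {c})"
        by (rule compactE_image[of _ "(\<lambda>y. y k) ` K" "\<lambda>c. {c}"]) (auto intro: discrete_topology_class.open_discrete)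
      then show ?thesis
        using finite_subset by auto
    qed
    then have "K \<subseteq> vertical_section P (\<lambda>k. Max ((\<lambda>y. y k) ` K))"
      unfolding section_P by (auto simp: PiE_def)
    then show ?thesis by blast
  qed
  ultimately show ?thesis
    using fsigma_universal_for_sigma_ideal[of euclidean P "{K. compact K}"] \<open>closed P\<close> by simp
qed

lemma nowhere_dense_in_subset:
  assumes "nowhere_dense_in X S" "T \<subseteq> S"
  shows "nowhere_dense_in X T"
  using assms interior_of_mono[OF closure_of_mono[OF assms(2), of X], of X]
  unfolding nowhere_dense_in_def by auto

lemma meager_in_eq_sigma_ideal:
  "{A. meager_in X A} = sigma_ideal_generated {S. nowhere_dense_in X S}"
proof (intro equalityI subsetI)
  fix A assume "A \<in> sigma_ideal_generated {S. nowhere_dense_in X S}"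
  then obtain \<G> where \<G>: "countable \<G>" "\<G> \<subseteq> {S. nowhere_dense_in X S}" "A \<subseteq> \<Union>\<G>"
    unfolding sigma_ideal_generated_def by blast
  have "A = \<Union>((\<inter>) A ` \<G>)"
    using \<G>(3) by blast
  moreover have "nowhere_dense_in X (A \<inter> G)" if "G \<in> \<G>" for G
    using nowhere_dense_in_subset[of X G "A \<inter> G"] \<G>(2) that by blast
  ultimately show "A \<in> {A. meager_in X A}"
    unfolding meager_in_def using \<G>(1) by blast
qed (auto simp: sigma_ideal_generated_def meager_in_def)

text \<open>
  A closed set is nowhere dense iff the complement includes a nonempty open subset of each nonempty
  basic set \<open>b n\<close>; the code \<open>x n\<close> names such a subset, which may be taken from the base.
\<close>

lemma fsigma_universal_for_meager:
  assumes "second_countable X"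
  shows "\<exists>U. fsigma_in (prod_topology euclidean X) U \<and>
             universal_for U (topspace X) {A. meager_in X A}"
proof -
  obtain b :: "nat \<Rightarrow> 'a set" where b0: "b 0 = {}" and bo: "\<And>n. openin X (b n)"
    and bU: "\<And>U. openin X U \<Longrightarrow> (\<Union>n. b (if b n \<subseteq> U then n else 0)) = U"
    by (rule second_countable_enumerated_base[OF assms]) (rule that)
  have base: "\<exists>n. y \<in> b n \<and> b n \<subseteq> U" if U: "openin X U" "y \<in> U" for U y
  proof -
    obtain n where "y \<in> b (if b n \<subseteq> U then n else 0)"
      using U(2) bU[OF U(1)] by blast
    then show ?thesis
      using b0 by (auto split: if_splits)
  qed
  \<comment> \<open>The default \<open>b n\<close> keeps the deleted open set dense when \<open>m\<close> is not a valid code.\<close>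
  define c where "c n m = (if b m \<noteq> {} \<and> b m \<subseteq> b n then b m else b n)" for n m
  have c: "openin X (c n m)" "c n m \<subseteq> b n" "b n \<noteq> {} \<Longrightarrow> c n m \<noteq> {}" for n m
    using bo unfolding c_def by auto
  have "nowhere_dense_in X (vertical_section (omitting X c) x)" for x
  proof -
    let ?V = "\<Union>n. c n (x n)"
    have "closedin X (topspace X - ?V)"
      using c(1) by (intro closedin_diff closedin_topspace openin_Union) auto
    moreover have "X interior_of (topspace X - ?V) = {}"
    proof (rule ccontr)
      assume "X interior_of (topspace X - ?V) \<noteq> {}"
      then obtain n where "b n \<noteq> {}" "b n \<subseteq> X interior_of (topspace X - ?V)"
        using base[OF openin_interior_of] by blast
      then show False
        using c(2,3)[of n "x n"] interior_of_subset[of X "topspace X - ?V"] by blast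
    qed
    ultimately show ?thesis
      unfolding nowhere_dense_in_def vertical_section_omitting
      by (simp add: closure_of_closedin)
  qed
  moreover have "\<exists>x. S \<subseteq> vertical_section (omitting X c) x" if S: "nowhere_dense_in X S" for S
  proof -
    have "\<exists>m. c n m \<inter> X closure_of S = {}" for n
    proof (cases "b n \<subseteq> X closure_of S")
      case True
      then have "b n = {}"
        using S interior_of_maximal[OF True bo] unfolding nowhere_dense_in_def by blast
      then show ?thesis
        using c(2) by blast
    next
      case False
      have "openin X (b n - X closure_of S)"
        by (intro openin_diff bo closedin_closure_of)
      then obtain m where "b m \<noteq> {}" "b m \<subseteq> b n - X closure_of S"
        using base False by blast
      then have "c n m \<inter> X closure_of S = {}"
        unfolding c_def by auto
      then show ?thesis by blast
    qed
    then obtain x where "\<And>n. c n (x n) \<inter> X closure_of S = {}"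
      by metis
    moreover have "S \<subseteq> topspace X" "S \<subseteq> X closure_of S"
      using S closure_of_subset unfolding nowhere_dense_in_def by auto
    ultimately show ?thesis
      unfolding vertical_section_omitting by blast
  qed
  ultimately show ?thesis
    unfolding meager_in_eq_sigma_ideal
    by (intro fsigma_universal_for_sigma_ideal[OF closedin_omitting[of X c]] c(1)) auto
qed

section \<open>Null sets and closed null sets of a finite Borel measure\<close>

text \<open>
  The complement of a closed null set has full measure, and by continuity from below so have, up to
  \<open>(1/2)^n\<close>, finite unions of the basic open sets inside it. Hence a closed null set avoids, for every
  \<open>n\<close>, a finite union \<open>D m\<close> of basic sets of measure at least \<open>measure M UNIV - (1/2)^n\<close>;
  conversely, avoiding such sets for all \<open>n\<close> forces measure zero.
\<close>

lemma fsigma_universal_for_closed_null: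
  fixes M :: "'a::second_countable_topology measure"
  assumes "finite_measure M" and sets_M: "sets M = sets borel"
  shows "\<exists>U. fsigma_in (prod_topology euclidean euclidean) U \<and>
             universal_for U UNIV (sigma_ideal_generated {C. closed C \<and> C \<in> null_sets M})"
proof -
  interpret finite_measure M by fact
  have space_M: "space M = UNIV"
    using sets_eq_imp_space_eq[OF sets_M] by simp
  have open_sets: "open V \<Longrightarrow> V \<in> sets M" for V
    unfolding sets_M by simp
  obtain b :: "nat \<Rightarrow> 'a set" where b: "\<And>n. open (b n)"
    and bU: "\<And>U. open U \<Longrightarrow> (\<Union>n. b (if b n \<subseteq> U then n else 0)) = U"
    by (rule open_enumerated_base) (rule that)
  define D where "D m = (\<Union>i\<in>set_decode m. b i)" for m
  \<comment> \<open>An invalid code deletes everything, which leaves the empty set.\<close>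
  define c where "c n m = (if measure M UNIV - (1/2)^n \<le> measure M (D m) then D m else UNIV)"
    for n m
  have c: "open (c n m)" "measure M UNIV - (1/2)^n \<le> measure M (c n m)" for n m
    using b unfolding c_def D_def by auto
  define P where "P = omitting euclidean c"
  have section_P: "vertical_section P x = - (\<Union>n. c n (x n))" for x
    unfolding P_def vertical_section_omitting by auto
  have closed_section: "closed (vertical_section P x)" for x
    unfolding section_P using c(1) by auto
  have "vertical_section P x \<in> null_sets M" for x
  proof -
    have "measure M (vertical_section P x) \<le> (1/2)^n" for n
    proof -
      have "measure M (vertical_section P x) \<le> measure M (space M - c n (x n))"
      proof (rule finite_measure_mono)
        show "space M - c n (x n) \<in> sets M"
          using c(1) open_sets by auto
      qed (auto simp: section_P space_M)
      also have "\<dots> \<le> (1/2)^n"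
        using c[of n "x n"] open_sets by (subst finite_measure_compl) (auto simp: space_M)
      finally show ?thesis .
    qed
    moreover have "(\<lambda>n. (1/2::real)^n) \<longlonglongrightarrow> 0"
      by (rule LIMSEQ_realpow_zero) auto
    ultimately have "measure M (vertical_section P x) \<le> 0"
      by (intro LIMSEQ_le_const) auto
    then show ?thesis
      using closed_section[of x] measure_nonneg[of M]
      by (intro null_setsI) (auto simp: emeasure_eq_measure sets_M antisym)
  qed
  moreover have "\<exists>x. F \<subseteq> vertical_section P x" if F: "closed F" "F \<in> null_sets M" for F
  proof -
    define s where "s n = (if b n \<subseteq> - F then n else 0)" for n
    have F_s: "- F = (\<Union>n. b (s n))"
        unfolding s_def using bU[of "- F"] F(1) by (simp add: open_Compl)
    define V where "V k = (\<Union>i\<in>s ` {..<k}. b i)" for k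
    have "V k \<subseteq> V l" if "k \<le> l" for k l
      using that unfolding V_def by (intro UN_mono image_mono) auto
    then have "(\<lambda>k. measure M (V k)) \<longlonglongrightarrow> measure M (\<Union>k. V k)"
      using b by (intro finite_Lim_measure_incseq)
        (auto simp: V_def incseq_def intro!: open_sets)
    moreover have "(\<Union>k. V k) = space M - F"
      using F_s unfolding V_def space_M by (auto simp: Compl_eq_Diff_UNIV[symmetric])
    moreover have "measure M (space M - F) = measure M UNIV"
      using F(2) by (subst finite_measure_compl) (auto simp: space_M measure_def)
    ultimately have lim: "(\<lambda>k. measure M (V k)) \<longlonglongrightarrow> measure M UNIV"
      by simp
    have "\<exists>m. D m \<subseteq> - F \<and> measure M UNIV - (1/2)^n \<le> measure M (D m)" for n
    proof -
      have "\<forall>\<^sub>F k in sequentially. measure M UNIV - (1/2)^n < measure M (V k)"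
        using lim by (rule order_tendstoD) simp
      then obtain k where k: "measure M UNIV - (1/2)^n < measure M (V k)"
        using eventually_happens by force
      have "D (set_encode (s ` {..<k})) = V k"
        unfolding D_def V_def by simp
      moreover have "V k \<subseteq> - F"
        unfolding F_s V_def by auto
      ultimately show ?thesis
        using k by (intro exI[of _ "set_encode (s ` {..<k})"]) auto
    qed
    then obtain x where "\<And>n. D (x n) \<subseteq> - F \<and> measure M UNIV - (1/2)^n \<le> measure M (D (x n))"
      by metis
    then have "F \<subseteq> vertical_section P x"
      unfolding section_P c_def by auto
    then show ?thesis by blast
  qed
  moreover have "closedin (prod_topology euclidean euclidean) P"
    unfolding P_def using c(1) by (intro closedin_omitting) auto
  ultimately show ?thesis
    using fsigma_universal_for_sigma_ideal[of euclidean P "{C. closed C \<and> C \<in> null_sets M}"]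
      closed_section by simp
qed

text \<open>
  The measure bound on a whole open set is a closed condition on its code, which would spoil openness
  of \<open>W\<close>. Testing instead, before the \<open>n\<close>-th basic set is accepted, whether the union of the
  first ones up to \<open>n\<close> is small depends on finitely many coordinates, and the measure of what has
  been accepted never exceeds \<open>e\<close>.
\<close>

lemma ex_open_coding_small_open_sets:
  fixes M :: "'a::second_countable_topology measure"
  assumes "finite_measure M" and sets_M: "sets M = sets borel" and "e \<ge> 0"
  shows "\<exists>W :: ((nat \<Rightarrow> nat) \<times> 'a) set. open W \<and>
    (\<forall>x. open (vertical_section W x) \<and> measure M (vertical_section W x) \<le> e) \<and>
    (\<forall>V. open V \<longrightarrow> measure M V \<le> e \<longrightarrow> (\<exists>x. vertical_section W x = V))"
proof -
  interpret finite_measure M by fact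
  have open_sets: "open V \<Longrightarrow> V \<in> sets M" for V
    unfolding sets_M by simp
  obtain b :: "nat \<Rightarrow> 'a set" where b: "\<And>n. open (b n)"
    and bU: "\<And>U. open U \<Longrightarrow> (\<Union>n. b (if b n \<subseteq> U then n else 0)) = U"
    by (rule open_enumerated_base) (rule that)
  define small where "small x n \<longleftrightarrow> measure M (\<Union>i\<le>n. b (x i)) \<le> e" for x :: "nat \<Rightarrow> nat" and n
  define W where "W = {p. \<exists>n. small (fst p) n \<and> snd p \<in> b (fst p n)}"
  have section_W: "vertical_section W x = (\<Union>n\<in>{n. small x n}. b (x n))" for x
    unfolding W_def vertical_section_def by auto
  show ?thesis
  proof (intro exI[of _ W] conjI allI impI)
    show "open W"
    proof (rule open_if_eventually_nhds)
      fix p assume "p \<in> W"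
      then obtain n where n: "small (fst p) n" "snd p \<in> b (fst p n)"
        unfolding W_def by blast
      have "\<forall>\<^sub>F q in nhds p. \<forall>i\<in>{..n}. fst q i = fst p i"
        by (intro eventually_ball_finite ballI eventually_nhds_fst_coordinate) simp
      moreover have "\<forall>\<^sub>F q in nhds p. q \<in> snd -` b (fst p n)"
        using n(2) b by (intro eventually_nhds_in_open open_vimage continuous_on_snd continuous_on_id) auto
      ultimately show "\<forall>\<^sub>F q in nhds p. q \<in> W"
      proof eventually_elim
        case (elim q)
        then have "small (fst q) n"
          using n(1) unfolding small_def by simp
        then show ?case
          using elim unfolding W_def by auto
      qed
    qed
    show "open (vertical_section W x)" for x
      unfolding section_W using b by blast
    show "measure M (vertical_section W x) \<le> e" for x
    proof -
      \<comment> \<open>The part of the section accepted up to stage \<open>n\<close>: it grows at \<open>Suc n\<close> only if the union of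
        all basic sets listed so far is small, and that union includes it.\<close>
      define E where "E n = (\<Union>i\<in>{i. i \<le> n \<and> small x i}. b (x i))" for n
      have E_le: "measure M (E n) \<le> e" for n
      proof (induction n)
        case 0
        show ?case
        proof (cases "small x 0")
          case True
          then have "E 0 = (\<Union>i\<le>0. b (x i))"
            unfolding E_def by auto
          then show ?thesis
            using True unfolding small_def by simp
        next
          case False
          then have "E 0 = {}"
            unfolding E_def by auto
          then show ?thesis
            using \<open>e \<ge> 0\<close> by simp
        qed
      next
        case (Suc n)
        show ?case
        proof (cases "small x (Suc n)")
          case True
          have "measure M (E (Suc n)) \<le> measure M (\<Union>i\<le>Suc n. b (x i))"
            using b by (intro finite_measure_mono open_sets open_UN) (auto simp: E_def)
          also have "\<dots> \<le> e"
            using True unfolding small_def .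
          finally show ?thesis .
        next
          case False
          then have "E (Suc n) = E n"
            unfolding E_def using le_Suc_eq by blast
          then show ?thesis
            using Suc by simp
        qed
      qed
      have "E m \<subseteq> E n" if "m \<le> n" for m n
        using that unfolding E_def by (intro UN_mono) auto
      then have "(\<lambda>n. measure M (E n)) \<longlonglongrightarrow> measure M (\<Union>n. E n)"
        using b by (intro finite_Lim_measure_incseq)
          (auto simp: E_def incseq_def intro!: open_sets)
      moreover have "(\<Union>n. E n) = vertical_section W x"
        unfolding E_def section_W by auto
      ultimately show ?thesis
        using E_le by (intro LIMSEQ_le_const2) auto
    qed
    show "\<exists>x. vertical_section W x = V" if V: "open V" "measure M V \<le> e" for V
    proof -
      define s where "s n = (if b n \<subseteq> V then n else 0)" for n
      have V_s: "V = (\<Union>n. b (s n))"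
        unfolding s_def using bU[OF V(1)] by simp
      have "small s n" for n
      proof -
        have "measure M (\<Union>i\<le>n. b (s i)) \<le> measure M V"
          using V(1) by (intro finite_measure_mono open_sets) (auto simp: V_s)
        then show ?thesis
          using V(2) unfolding small_def by simp
      qed
      then have "vertical_section W s = V"
        unfolding section_W V_s by auto
      then show ?thesis by blast
    qed
  qed
qed

text \<open>
  Outer regularity at null sets makes each null set a subset of some
  \<open>\<Inter>k. vertical_section (W k) (row k x)\<close>, where \<open>W k\<close> codes the open sets of measure at most \<open>(1/2)^k\<close>.
\<close>

lemma gdelta_universal_for_null:
  fixes M :: "'a::second_countable_topology measure"
  assumes "finite_measure M" and sets_M: "sets M = sets borel"
    and outer: "\<And>N e. N \<in> null_sets M \<Longrightarrow> e > 0 \<Longrightarrow> \<exists>V. open V \<and> N \<subseteq> V \<and> measure M V \<le> e"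
  shows "\<exists>U. gdelta_in (prod_topology euclidean euclidean) U \<and>
             universal_for U UNIV {A. \<exists>N\<in>null_sets M. A \<subseteq> N}"
proof -
  interpret finite_measure M by fact
  have open_sets: "open V \<Longrightarrow> V \<in> sets M" for V
    unfolding sets_M by simp
  have "\<exists>W :: ((nat \<Rightarrow> nat) \<times> 'a) set. open W \<and>
      (\<forall>x. open (vertical_section W x) \<and> measure M (vertical_section W x) \<le> (1/2)^k) \<and>
      (\<forall>V. open V \<longrightarrow> measure M V \<le> (1/2)^k \<longrightarrow> (\<exists>x. vertical_section W x = V))" for k :: nat
    using assms(1,2) by (rule ex_open_coding_small_open_sets) simp
  then obtain W :: "nat \<Rightarrow> ((nat \<Rightarrow> nat) \<times> 'a) set" where
    W: "\<And>k. open (W k)" "\<And>k x. open (vertical_section (W k) x)"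
      "\<And>k x. measure M (vertical_section (W k) x) \<le> (1/2)^k"
    and W_cofinal: "\<And>k V. open V \<Longrightarrow> measure M V \<le> (1/2)^k \<Longrightarrow> \<exists>x. vertical_section (W k) x = V"
    by metis
  define U where "U = (\<Inter>k. (\<lambda>(x, y). (row k x, y)) -` W k)"
  have "continuous_on UNIV (\<lambda>(x :: nat \<Rightarrow> nat, y :: 'a). (row k x, y))" for k
    using continuous_map_row[of euclidean k] by simp
  then have "open ((\<lambda>(x, y). (row k x, y)) -` W k)" for k
    using W(1) by (intro open_vimage) auto
  then have gdelta: "gdelta_in (prod_topology euclidean euclidean) U"
    unfolding U_def by (simp add: gdelta_in_INT_open)
  have section_U: "vertical_section U x = (\<Inter>k. vertical_section (W k) (row k x))" for x
    unfolding U_def vertical_section_def by auto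
  have null: "vertical_section U x \<in> null_sets M" for x
  proof -
    have sets_U: "vertical_section U x \<in> sets M"
      unfolding section_U using W(2) open_sets by (intro sets.countable_INT) auto
    have "measure M (vertical_section U x) \<le> (1/2)^k" for k
    proof -
      have "measure M (vertical_section U x) \<le> measure M (vertical_section (W k) (row k x))"
        using W(2) open_sets by (intro finite_measure_mono) (auto simp: section_U)
      then show ?thesis
        using W(3)[of k "row k x"] by simp
    qed
    moreover have "(\<lambda>n. (1/2::real)^n) \<longlonglongrightarrow> 0"
      by (rule LIMSEQ_realpow_zero) auto
    ultimately have "measure M (vertical_section U x) \<le> 0"
      by (intro LIMSEQ_le_const) auto
    then show ?thesis
      using sets_U measure_nonneg[of M]
      by (intro null_setsI) (auto simp: emeasure_eq_measure antisym)
  qed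
  moreover have "\<exists>x. A \<subseteq> vertical_section U x" if A: "A \<subseteq> N" "N \<in> null_sets M" for A N
  proof -
    have "\<exists>z. N \<subseteq> vertical_section (W k) z" for k
      using outer[OF A(2), of "(1/2)^k"] W_cofinal[of _ k] by force
    then obtain z where z: "\<And>k. N \<subseteq> vertical_section (W k) (z k)"
      by metis
    obtain x where "\<And>k. row k x = z k"
      using ex_rows[of z] by blast
    then have "N \<subseteq> vertical_section U x"
      using z unfolding section_U by auto
    then show ?thesis
      using A(1) by blast
  qed
  ultimately have "universal_for U UNIV {A. \<exists>N\<in>null_sets M. A \<subseteq> N}"
    by (intro universal_forI) auto
  then show ?thesis
    using gdelta by blast
qed

section \<open>The Haar measure as a regular Borel measure\<close>

instance bool :: second_countable_topology
proof
  show "\<exists>B::bool set set. countable B \<and> open = generate_topology B"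
    by (intro exI[of _ "range lessThan \<union> range greaterThan"]) (auto simp: open_bool_def fun_eq_iff)
qed

lemma sets_haar: "sets haar = sets borel"
proof -
  have "sets haar = sets (Pi\<^sub>M UNIV (\<lambda>_::nat. borel :: bool measure))"
    unfolding haar_def
    by (intro sets_PiM_cong) (auto simp: sets_borel_eq_count_space sets_uniform_count_measure)
  then show ?thesis
    by (simp add: sets_PiM_equal_borel)
qed

lemma prob_space_haar: "prob_space haar"
  unfolding haar_def by (intro prob_space_PiM prob_space_uniform_count_measure) auto

text \<open>
  Outer regularity holds for finite Borel measures on complete separable metric spaces. It is
  transported along the embedding \<open>h\<close> of the Cantor space into the space of real sequences: the
  preimage under a Borel left inverse \<open>g\<close> of \<open>h\<close> turns a null set into a null set of the image measure.
\<close>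

lemma haar_null_outer_regular:
  assumes N: "N \<in> null_sets haar" and "e > 0"
  shows "\<exists>V. open V \<and> N \<subseteq> V \<and> measure haar V \<le> e"
proof -
  interpret prob_space haar by (rule prob_space_haar)
  define h :: "(nat \<Rightarrow> bool) \<Rightarrow> nat \<Rightarrow> real" where "h y i = of_bool (y i)" for y i
  define g :: "(nat \<Rightarrow> real) \<Rightarrow> nat \<Rightarrow> bool" where "g z i \<longleftrightarrow> z i \<noteq> 0" for z i
  have gh: "g (h y) = y" for y
    by (auto simp: g_def h_def)
  have "continuous_on UNIV (\<lambda>y. h y i)" for i
  proof -
    have "continuous_on UNIV (of_bool :: bool \<Rightarrow> real)"
      by (auto simp: continuous_on_open_vimage discrete_topology_class.open_discrete)
    then show ?thesis
      unfolding h_def by (rule continuous_on_compose2) (auto intro: continuous_on_product_coordinates)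
  qed
  then have cont_h: "continuous_on UNIV h"
    by (intro continuous_on_coordinatewise_then_product)
  have h[measurable]: "h \<in> measurable haar borel"
    using borel_measurable_continuous_onI[OF cont_h] measurable_cong_sets[OF sets_haar refl] by blast
  have "g \<in> borel_measurable borel"
  proof (rule measurable_coordinatewise_then_product)
    fix i
    have "(\<lambda>z :: nat \<Rightarrow> real. z i \<noteq> 0) \<in> measurable borel (count_space UNIV)"
      by measurable
    then show "(\<lambda>z. g z i) \<in> borel_measurable borel"
      unfolding g_def using measurable_cong_sets[OF refl sets_borel_eq_count_space] by blast
  qed
  then have B: "g -` N \<in> sets borel"
    using N measurable_sets[of g borel borel N] sets_haar by auto
  have space_haar: "space haar = UNIV"
    using sets_eq_imp_space_eq[OF sets_haar] by simp
  have "emeasure (distr haar borel h) (g -` N) = emeasure haar N"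
    using B by (subst emeasure_distr) (auto simp: vimage_def gh space_haar)
  then have "emeasure (distr haar borel h) (g -` N) = 0"
    using N by auto
  moreover interpret h: prob_space "distr haar borel h"
    by (rule prob_space_distr) measurable
  have "emeasure (distr haar borel h) (g -` N)
      = (INF U\<in>{U. g -` N \<subseteq> U \<and> open U}. emeasure (distr haar borel h) U)"
    using B by (intro outer_regular) auto
  ultimately have "(INF U\<in>{U. g -` N \<subseteq> U \<and> open U}. emeasure (distr haar borel h) U) < ennreal e"
    using \<open>e > 0\<close> by simp
  then obtain U where U: "g -` N \<subseteq> U" "open U" "emeasure (distr haar borel h) U < ennreal e"
    by (auto simp: INF_less_iff)
  have "emeasure haar (h -` U) < ennreal e"
    using U by (subst (asm) emeasure_distr) (auto simp: space_haar)
  then have "measure haar (h -` U) \<le> e"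
    using \<open>e > 0\<close> by (simp add: emeasure_eq_measure ennreal_less_iff)
  moreover have "open (h -` U)"
    using U(2) cont_h by (intro open_vimage)
  moreover have "N \<subseteq> h -` U"
    using U(1) gh by auto
  ultimately show ?thesis
    by blast
qed

section \<open>The Laver ideal\<close>

text \<open>
  The set \<open>B n\<close> of pairs \<open>(x, f)\<close> with \<open>f n < \<Phi> (f|n)\<close>, where \<open>x\<close> codes \<open>\<Phi>\<close>, is open although the
  coordinate of \<open>x\<close> that it reads depends on \<open>f\<close>: near a given pair, \<open>f|n\<close> is constant.
\<close>

lemma gdelta_universal_for_laver_ideal:
  "\<exists>U. gdelta_in (prod_topology euclidean euclidean) U \<and> universal_for U UNIV laver_ideal"
proof -
  define B where "B n = {p :: (nat \<Rightarrow> nat) \<times> (nat \<Rightarrow> nat).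
    snd p n < fst p (to_nat (map (snd p) [0..<n]))}" for n
  have "open (B n)" for n
  proof (rule open_if_eventually_nhds)
    fix p assume p: "p \<in> B n"
    have "\<forall>\<^sub>F q in nhds p. \<forall>i\<in>{..n}. snd q i = snd p i"
      by (intro eventually_ball_finite ballI eventually_nhds_snd_coordinate) simp
    moreover have "\<forall>\<^sub>F q in nhds p.
        fst q (to_nat (map (snd p) [0..<n])) = fst p (to_nat (map (snd p) [0..<n]))"
      by (rule eventually_nhds_fst_coordinate)
    ultimately show "\<forall>\<^sub>F q in nhds p. q \<in> B n"
    proof eventually_elim
      case (elim q)
      then have "map (snd q) [0..<n] = map (snd p) [0..<n]"
        by auto
      with elim p show ?case
        unfolding B_def mem_Collect_eq by (metis atMost_iff order_refl)
    qed
  qed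
  define U where "U = (\<Inter>m. \<Union>n\<in>{m..}. B n)"
  have gdelta: "gdelta_in (prod_topology euclidean euclidean) U"
    unfolding U_def prod_topology_euclidean
    using \<open>\<And>n. open (B n)\<close> by (intro gdelta_in_INT_open) auto
  have section_U: "f \<in> vertical_section U x \<longleftrightarrow>
      \<not> (\<forall>\<^sub>F n in sequentially. f n \<ge> x (to_nat (map f [0..<n])))" for f x
    unfolding U_def vertical_section_def B_def eventually_sequentially by (auto simp: not_le)
  have "vertical_section U x \<in> laver_ideal" for x
    unfolding laver_ideal_def strongly_dominating_def
    using section_U[of _ x] by (auto intro!: exI[of _ "\<lambda>s. x (to_nat s)"])
  moreover have "\<exists>x. A \<subseteq> vertical_section U x" if A: "A \<in> laver_ideal" for A
  proof -
    obtain \<Phi> :: "nat list \<Rightarrow> nat" where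
      \<Phi>: "\<And>f. f \<in> A \<Longrightarrow> \<not> (\<forall>\<^sub>F n in sequentially. f n \<ge> \<Phi> (map f [0..<n]))"
      using A unfolding laver_ideal_def strongly_dominating_def by auto
    have "A \<subseteq> vertical_section U (\<lambda>m. \<Phi> (from_nat m))"
      using \<Phi> by (auto simp: section_U)
    then show ?thesis by blast
  qed
  ultimately have "universal_for U UNIV laver_ideal"
    by (intro universal_forI) auto
  then show ?thesis
    using gdelta by blast
qed

section \<open>The universal sets\<close>

theorem theorem2p1:
  shows
    "(\<exists>U. fsigma_in (prod_topology euclidean euclidean) U \<and>
          universal_for U UNIV {A :: (nat \<Rightarrow> nat) set. countable A}) \<and>
     (\<forall>X :: 'a topology. Polish_space X \<longrightarrow>
        (\<exists>U. fsigma_in (prod_topology euclidean X) U \<and>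
             universal_for U (topspace X) {A. meager_in X A})) \<and>
     (\<exists>U. gdelta_in (prod_topology euclidean euclidean) U \<and>
          universal_for U UNIV {A :: (nat \<Rightarrow> bool) set. haar_null A}) \<and>
     (\<exists>U. fsigma_in (prod_topology euclidean euclidean) U \<and>
          universal_for U UNIV
            (sigma_ideal_generated {C :: (nat \<Rightarrow> bool) set. closed C \<and> C \<in> null_sets haar})) \<and>
     (\<exists>U. fsigma_in (prod_topology euclidean euclidean) U \<and>
          universal_for U UNIV
            (sigma_ideal_generated {K :: (nat \<Rightarrow> nat) set. compact K})) \<and>
     (\<exists>U. gdelta_in (prod_topology euclidean euclidean) U \<and>
          universal_for U UNIV laver_ideal)"
proof (intro conjI allI impI)
  fix X :: "'a topology"
  assume "Polish_space X"
  then have "second_countable X"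
    unfolding Polish_space_def
    by (intro separable_metrizable_imp_second_countable completely_metrizable_imp_metrizable_space) auto
  then show "\<exists>U. fsigma_in (prod_topology euclidean X) U \<and>
      universal_for U (topspace X) {A. meager_in X A}"
    by (rule fsigma_universal_for_meager)
next
  show "\<exists>U. gdelta_in (prod_topology euclidean euclidean) U \<and>
      universal_for U UNIV {A :: (nat \<Rightarrow> bool) set. haar_null A}"
    unfolding haar_null_def
    by (intro gdelta_universal_for_null sets_haar haar_null_outer_regular
        prob_space.finite_measure prob_space_haar)
next
  show "\<exists>U. fsigma_in (prod_topology euclidean euclidean) U \<and>
      universal_for U UNIV
        (sigma_ideal_generated {C :: (nat \<Rightarrow> bool) set. closed C \<and> C \<in> null_sets haar})"
    by (intro fsigma_universal_for_closed_null sets_haar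
        prob_space.finite_measure prob_space_haar)
qed (fact fsigma_universal_for_countable fsigma_universal_for_K_sigma
    gdelta_universal_for_laver_ideal)+

end
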